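(* Let $S=\langle\{\mathbb{Z}^n\xrightarrow{A_i}\mathbb{Z}^n\}_{i=1}^N\rangle$ be a sieve on $\mathbb{Z}^n$ in the category of abelian groups, where each $A_i$ is a diagonal integer matrix with $\det(A_i)\neq 0$. Then there exists a map $\beta\colon\mathbb{Z}\to\mathbb{Z}^n$ such that $\beta^\ast S$ is not a colim sieve if and only if $\gcd(\det(A_1),\dots,\det(A_N))\neq 1$.
   Context: A sieve $S$ on an object $X$ of a category is a collection of morphisms with codomain $X$ closed under precomposition; it is regarded as a full subcategory of the overcategory of $X$, with forgetful functor $U$ sending a morphism to its domain. For $f\colon Y\to X$, $f^\ast S=\{h \text{ with codomain } Y : f\circ h\in S\}$. $\langle\cdot\rangle$ denotes the sieve generated by a family, i.e. all morphisms factoring through a member of the family. $S$ is a colim sieve if $\operatorname{colim}_S U$ exists and the canonical map $\operatorname{colim}_S U\to X$ is an isomorphism. *)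

theory Defs
  imports
    "HOL-Algebra.Elementary_Groups"
    "HOL-Algebra.Weak_Morphisms"
    "Jordan_Normal_Form.Determinant"
begin

section \<open>Categories, functors, colimits\<close>

record ('o, 'm) cat =
  Obs :: "'o set"
  Ars :: "'m set"
  Dom :: "'m \<Rightarrow> 'o"
  Cod :: "'m \<Rightarrow> 'o"
  Idn :: "'o \<Rightarrow> 'm"
  Cmp :: "'m \<Rightarrow> 'm \<Rightarrow> 'm"  \<comment> \<open>\<open>Cmp C g f\<close> is "g after f"\<close>

definition Hom :: "('o, 'm) cat \<Rightarrow> 'o \<Rightarrow> 'o \<Rightarrow> 'm set" where
  "Hom C X Y = {f \<in> Ars C. Dom C f = X \<and> Cod C f = Y}"

locale category =
  fixes C :: "('o, 'm) cat"
  assumes Dom_in: "f \<in> Ars C \<Longrightarrow> Dom C f \<in> Obs C"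
    and Cod_in: "f \<in> Ars C \<Longrightarrow> Cod C f \<in> Obs C"
    and Idn_in: "X \<in> Obs C \<Longrightarrow> Idn C X \<in> Hom C X X"
    and Cmp_in: "\<lbrakk>f \<in> Hom C X Y; g \<in> Hom C Y Z\<rbrakk> \<Longrightarrow> Cmp C g f \<in> Hom C X Z"
    and Idn_left: "f \<in> Hom C X Y \<Longrightarrow> Cmp C (Idn C Y) f = f"
    and Idn_right: "f \<in> Hom C X Y \<Longrightarrow> Cmp C f (Idn C X) = f"
    and Cmp_assoc: "\<lbrakk>f \<in> Hom C W X; g \<in> Hom C X Y; h \<in> Hom C Y Z\<rbrakk>
      \<Longrightarrow> Cmp C h (Cmp C g f) = Cmp C (Cmp C h g) f"

definition is_iso :: "('o, 'm) cat \<Rightarrow> 'm \<Rightarrow> bool" where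
  "is_iso C f \<longleftrightarrow> f \<in> Ars C \<and>
     (\<exists>g \<in> Hom C (Cod C f) (Dom C f).
        Cmp C g f = Idn C (Dom C f) \<and> Cmp C f g = Idn C (Cod C f))"

record ('o, 'm, 'p, 'n) fctr =
  FOb :: "'o \<Rightarrow> 'p"
  FAr :: "'m \<Rightarrow> 'n"

definition is_functor :: "('o, 'm) cat \<Rightarrow> ('p, 'n) cat \<Rightarrow> ('o, 'm, 'p, 'n) fctr \<Rightarrow> bool" where
  "is_functor J C F \<longleftrightarrow>
     (\<forall>j \<in> Obs J. FOb F j \<in> Obs C) \<and>
     (\<forall>a \<in> Ars J. FAr F a \<in> Hom C (FOb F (Dom J a)) (FOb F (Cod J a))) \<and>
     (\<forall>j \<in> Obs J. FAr F (Idn J j) = Idn C (FOb F j)) \<and>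
     (\<forall>a \<in> Ars J. \<forall>b \<in> Ars J. Cod J a = Dom J b \<longrightarrow>
        FAr F (Cmp J b a) = Cmp C (FAr F b) (FAr F a))"

definition is_cocone ::
  "('o, 'm) cat \<Rightarrow> ('p, 'n) cat \<Rightarrow> ('o, 'm, 'p, 'n) fctr \<Rightarrow> 'p \<Rightarrow> ('o \<Rightarrow> 'n) \<Rightarrow> bool" where
  "is_cocone J C F c \<iota> \<longleftrightarrow> c \<in> Obs C \<and>
     (\<forall>j \<in> Obs J. \<iota> j \<in> Hom C (FOb F j) c) \<and>
     (\<forall>a \<in> Ars J. Cmp C (\<iota> (Cod J a)) (FAr F a) = \<iota> (Dom J a))"

definition is_colimit ::
  "('o, 'm) cat \<Rightarrow> ('p, 'n) cat \<Rightarrow> ('o, 'm, 'p, 'n) fctr \<Rightarrow> 'p \<Rightarrow> ('o \<Rightarrow> 'n) \<Rightarrow> bool" where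
  "is_colimit J C F c \<iota> \<longleftrightarrow> is_cocone J C F c \<iota> \<and>
     (\<forall>c' \<iota>'. is_cocone J C F c' \<iota>' \<longrightarrow>
        (\<exists>!u. u \<in> Hom C c c' \<and> (\<forall>j \<in> Obs J. Cmp C u (\<iota> j) = \<iota>' j)))"

section \<open>Overcategories and sieves\<close>

text \<open>An arrow \<open>(f, k, g)\<close> of the overcategory goes from \<open>f\<close> to \<open>g\<close>; it is the arrow \<open>k\<close>
  of the base category together with its source and target over \<open>X\<close>.\<close>

definition overcat :: "('o, 'm) cat \<Rightarrow> 'o \<Rightarrow> ('m, 'm \<times> 'm \<times> 'm) cat" where
  "overcat C X = \<lparr>
     Obs = {f \<in> Ars C. Cod C f = X},
     Ars = {(f, k, g). f \<in> Ars C \<and> Cod C f = X \<and> g \<in> Ars C \<and> Cod C g = X \<and>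
              k \<in> Hom C (Dom C f) (Dom C g) \<and> Cmp C g k = f},
     Dom = (\<lambda>(f, k, g). f),
     Cod = (\<lambda>(f, k, g). g),
     Idn = (\<lambda>f. (f, Idn C (Dom C f), f)),
     Cmp = (\<lambda>(f', k', g') (f, k, g). (f, Cmp C k' k, g'))\<rparr>"

definition full_subcat :: "('o, 'm) cat \<Rightarrow> 'o set \<Rightarrow> ('o, 'm) cat" where
  "full_subcat C S = C\<lparr>Obs := S, Ars := {a \<in> Ars C. Dom C a \<in> S \<and> Cod C a \<in> S}\<rparr>"

definition is_sieve :: "('o, 'm) cat \<Rightarrow> 'o \<Rightarrow> 'm set \<Rightarrow> bool" where
  "is_sieve C X S \<longleftrightarrow> X \<in> Obs C \<and> S \<subseteq> {f \<in> Ars C. Cod C f = X} \<and>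
     (\<forall>f \<in> S. \<forall>g \<in> Ars C. Cod C g = Dom C f \<longrightarrow> Cmp C f g \<in> S)"

definition generated_sieve :: "('o, 'm) cat \<Rightarrow> 'm set \<Rightarrow> 'm set" where
  "generated_sieve C F = {Cmp C f g |f g. f \<in> F \<and> g \<in> Ars C \<and> Cod C g = Dom C f}"

definition pullback_sieve :: "('o, 'm) cat \<Rightarrow> 'm \<Rightarrow> 'm set \<Rightarrow> 'm set" where
  "pullback_sieve C f S = {h \<in> Ars C. Cod C h = Dom C f \<and> Cmp C f h \<in> S}"

definition sieve_cat :: "('o, 'm) cat \<Rightarrow> 'o \<Rightarrow> 'm set \<Rightarrow> ('m, 'm \<times> 'm \<times> 'm) cat" where
  "sieve_cat C X S = full_subcat (overcat C X) S"

definition forgetful :: "('o, 'm) cat \<Rightarrow> ('m, 'm \<times> 'm \<times> 'm, 'o, 'm) fctr" where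
  "forgetful C = \<lparr>FOb = Dom C, FAr = (\<lambda>(f, k, g). k)\<rparr>"

text \<open>The canonical map \<open>u\<close> out of the colimit is the one induced by the tautological cocone,
  whose leg at the object \<open>f\<close> of \<open>S\<close> is \<open>f\<close> itself.\<close>

definition colim_sieve :: "('o, 'm) cat \<Rightarrow> 'o \<Rightarrow> 'm set \<Rightarrow> bool" where
  "colim_sieve C X S \<longleftrightarrow> is_sieve C X S \<and>
     (\<exists>c \<iota> u. is_colimit (sieve_cat C X S) C (forgetful C) c \<iota> \<and>
        u \<in> Hom C c X \<and> (\<forall>f \<in> S. Cmp C u (\<iota> f) = f) \<and> is_iso C u)"

section \<open>Abelian groups\<close>

datatype 'a ab_hom = AbHom (src: "'a monoid") (fn: "'a \<Rightarrow> 'a") (tgt: "'a monoid")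

text \<open>The category of abelian groups whose underlying set is a subset of the type \<open>'a\<close>.
  Underlying functions are normalised to be \<open>undefined\<close> outside the carrier of the source, so
  that equality of arrows is equality of homomorphisms.\<close>

definition Ab :: "('a monoid, 'a ab_hom) cat" where
  "Ab = \<lparr>
     Obs = {G. comm_group G},
     Ars = {AbHom G f H |G f H. comm_group G \<and> comm_group H \<and>
              f \<in> hom G H \<and> f \<in> extensional (carrier G)},
     Dom = src,
     Cod = tgt,
     Idn = (\<lambda>G. AbHom G (restrict id (carrier G)) G),
     Cmp = (\<lambda>g f. AbHom (src f) (compose (carrier (src f)) (fn g) (fn f)) (tgt g))\<rparr>"

text \<open>HOL has no type containing all groups. Groups are taken with elements in the following
  type: it contains the elements of every \<open>\<int>\<^sup>n\<close>, and \<open>'u\<close> is an arbitrary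
  type that bounds the size of the groups under consideration, so that a statement
  polymorphic in \<open>'u\<close> covers any collection of groups that fits into a type.\<close>

datatype 'u elt = Int_elt int | Vec_elt (the_vec: "int vec") | Other_elt 'u

definition Z_grp :: "'u elt monoid" where
  "Z_grp = image_group Int_elt integer_group"

definition Zn_grp :: "nat \<Rightarrow> 'u elt monoid" where
  "Zn_grp n = image_group Vec_elt (monoid_vec TYPE(int) n)"

definition mat_hom :: "nat \<Rightarrow> int mat \<Rightarrow> 'u elt ab_hom" where
  "mat_hom n A = AbHom (Zn_grp n)
     (restrict (\<lambda>x. Vec_elt (A *\<^sub>v the_vec x)) (carrier (Zn_grp n))) (Zn_grp n)"

section \<open>Well-formedness\<close>

lemma category_overcat:
  assumes "category C" shows "category (overcat C X)"
proof -
  interpret category C by fact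
  show ?thesis
  proof
    fix f assume "f \<in> Ars (overcat C X)"
    then show "Dom (overcat C X) f \<in> Obs (overcat C X)" "Cod (overcat C X) f \<in> Obs (overcat C X)"
      by (auto simp: overcat_def)
  next
    fix f assume "f \<in> Obs (overcat C X)"
    then show "Idn (overcat C X) f \<in> Hom (overcat C X) f f"
      using Dom_in Idn_in Idn_right by (auto simp: overcat_def Hom_def)
  next
    fix a b f g h assume "a \<in> Hom (overcat C X) f g" "b \<in> Hom (overcat C X) g h"
    then obtain k l where *: "a = (f, k, g)" "b = (g, l, h)"
      "k \<in> Hom C (Dom C f) (Dom C g)" "l \<in> Hom C (Dom C g) (Dom C h)"
      "h \<in> Hom C (Dom C h) X" "f \<in> Ars C" "Cod C f = X" "Cmp C g k = f" "Cmp C h l = g"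
      by (auto simp: overcat_def Hom_def)
    have "Cmp C h (Cmp C l k) = f" using Cmp_assoc[OF *(3-5)] *(8,9) by simp
    then show "Cmp (overcat C X) b a \<in> Hom (overcat C X) f h"
      using * Cmp_in[OF *(3,4)] by (simp add: overcat_def Hom_def)
  next
    fix a f g assume "a \<in> Hom (overcat C X) f g"
    then obtain k where "a = (f, k, g)" "k \<in> Hom C (Dom C f) (Dom C g)"
      by (auto simp: overcat_def Hom_def)
    then show "Cmp (overcat C X) (Idn (overcat C X) g) a = a"
      "Cmp (overcat C X) a (Idn (overcat C X) f) = a"
      using Idn_left Idn_right by (auto simp: overcat_def)
  next
    fix a b c f g h k
    assume "a \<in> Hom (overcat C X) f g" "b \<in> Hom (overcat C X) g h" "c \<in> Hom (overcat C X) h k"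
    then show "Cmp (overcat C X) c (Cmp (overcat C X) b a) =
        Cmp (overcat C X) (Cmp (overcat C X) c b) a"
      using Cmp_assoc by (auto simp: overcat_def Hom_def)
  qed
qed

lemma category_full_subcat:
  assumes "category C" "S \<subseteq> Obs C" shows "category (full_subcat C S)"
proof -
  interpret category C by fact
  show ?thesis
    using assms(2) Idn_in Cmp_in Idn_left Idn_right Cmp_assoc
    by unfold_locales (auto simp: full_subcat_def Hom_def)
qed

lemma is_functor_forgetful:
  assumes "category C" "is_sieve C X S"
  shows "is_functor (sieve_cat C X S) C (forgetful C)"
proof -
  interpret category C by fact
  show ?thesis
    using assms Dom_in
    by (auto simp: is_functor_def sieve_cat_def full_subcat_def overcat_def forgetful_def
        Hom_def is_sieve_def)
qed

lemma is_sieve_generated: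
  assumes "category C" "X \<in> Obs C" "F \<subseteq> {f \<in> Ars C. Cod C f = X}"
  shows "is_sieve C X (generated_sieve C F)"
proof -
  interpret category C by fact
  have "Cmp C f g \<in> {f \<in> Ars C. Cod C f = X}" "Dom C (Cmp C f g) = Dom C g"
    if "f \<in> F" "g \<in> Ars C" "Cod C g = Dom C f" for f g
    using Cmp_in[of g "Dom C g" "Dom C f" f X] that assms(3) by (auto simp: Hom_def)
  moreover have "\<exists>f' g'. Cmp C (Cmp C f g) h = Cmp C f' g' \<and>
      f' \<in> F \<and> g' \<in> Ars C \<and> Cod C g' = Dom C f'"
    if "f \<in> F" "g \<in> Ars C" "Cod C g = Dom C f" "h \<in> Ars C" "Cod C h = Dom C g" for f g h
  proof -
    have "Cmp C f (Cmp C g h) = Cmp C (Cmp C f g) h"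
      using that assms(3) by (intro Cmp_assoc) (auto simp: Hom_def)
    moreover have "Cmp C g h \<in> Hom C (Dom C h) (Dom C f)"
      using that by (intro Cmp_in) (auto simp: Hom_def)
    ultimately show ?thesis using that(1) by (metis (mono_tags, lifting) Hom_def mem_Collect_eq)
  qed
  ultimately show ?thesis
    using assms(2) unfolding is_sieve_def generated_sieve_def by auto
qed

lemma is_sieve_pullback:
  assumes "category C" "is_sieve C X S" "f \<in> Hom C Y X"
  shows "is_sieve C Y (pullback_sieve C f S)"
proof -
  interpret category C by fact
  have "Cmp C h g \<in> pullback_sieve C f S"
    if "h \<in> pullback_sieve C f S" "g \<in> Ars C" "Cod C g = Dom C h" for h g
  proof -
    have h: "h \<in> Hom C (Dom C h) Y" "g \<in> Hom C (Dom C g) (Dom C h)" "Cmp C f h \<in> S"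
      using that assms(3) by (auto simp: pullback_sieve_def Hom_def)
    have "Dom C (Cmp C f h) = Dom C h"
      using Cmp_in[OF h(1) assms(3)] by (simp add: Hom_def)
    then have "Cmp C (Cmp C f h) g \<in> S"
      using assms(2) h(3) that(2,3) by (simp add: is_sieve_def)
    then show ?thesis
      using Cmp_assoc[OF h(2,1) assms(3)] Cmp_in[OF h(2,1)] assms(3)
      by (simp add: pullback_sieve_def Hom_def)
  qed
  then show ?thesis
    using assms(3) Dom_in by (auto simp: is_sieve_def pullback_sieve_def Hom_def)
qed

lemma Hom_Ab:
  "Hom Ab G H = {AbHom G f H |f. comm_group G \<and> comm_group H \<and>
     f \<in> hom G H \<and> f \<in> extensional (carrier G)}"
  by (auto simp: Hom_def Ab_def)

lemma category_Ab: "category Ab"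
proof
  fix G :: "'a monoid" assume "G \<in> Obs Ab"
  then show "Idn Ab G \<in> Hom Ab G G" by (auto simp: Hom_Ab) (auto simp: Ab_def hom_def comm_group_def
        group.is_monoid monoid.m_closed)
next
  fix f g :: "'a ab_hom" and X Y Z assume "f \<in> Hom Ab X Y" "g \<in> Hom Ab Y Z"
  then show "Cmp Ab g f \<in> Hom Ab X Z"
    by (auto simp: Hom_Ab) (auto simp: Ab_def Pi_iff hom_def compose_def comm_group_def
        group.is_monoid monoid.m_closed)
next
  fix f :: "'a ab_hom" and X Y assume "f \<in> Hom Ab X Y"
  then show "Cmp Ab (Idn Ab Y) f = f" "Cmp Ab f (Idn Ab X) = f"
    by (auto simp: Hom_Ab) (auto simp: Ab_def hom_def compose_def fun_eq_iff extensional_def Pi_iff)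
next
  fix f g h :: "'a ab_hom" and W X Y Z
  assume "f \<in> Hom Ab W X" "g \<in> Hom Ab X Y" "h \<in> Hom Ab Y Z"
  then show "Cmp Ab h (Cmp Ab g f) = Cmp Ab (Cmp Ab h g) f"
    by (auto simp: Hom_Ab) (auto simp: Ab_def compose_def fun_eq_iff hom_def Pi_iff)
qed (auto simp: Ab_def)

lemma comm_group_image_group:
  assumes "comm_group G" "inj_on f (carrier G)"
  shows "comm_group (image_group f G)"
proof -
  interpret comm_group G by fact
  show ?thesis
  proof (rule comm_groupI)
    show "\<exists>y\<in>carrier (image_group f G). y \<otimes>\<^bsub>image_group f G\<^esub> x = \<one>\<^bsub>image_group f G\<^esub>"
      if x: "x \<in> carrier (image_group f G)" for x
    proof -
      obtain y where y: "y \<in> carrier G" "x = f y"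
        using x by (auto simp: image_group_def)
      then show ?thesis
        by (intro bexI[of _ "f (inv\<^bsub>G\<^esub> y)"])
          (use assms(2) in \<open>simp_all add: image_group_def inv_into_f_f\<close>)
    qed
  qed (use assms(2) in \<open>auto simp: image_group_def inv_into_f_f m_ac\<close>)
qed

lemma comm_group_Z_grp: "comm_group Z_grp"
  unfolding Z_grp_def
  by (rule comm_group_image_group[OF abelian_integer_group]) (auto simp: inj_on_def)

lemma comm_group_Zn_grp: "comm_group (Zn_grp n)"
  unfolding Zn_grp_def
  by (rule comm_group_image_group[OF comm_group_vec]) (auto simp: inj_on_def)

lemma mat_hom_in_Hom:
  assumes "A \<in> carrier_mat n n"
  shows "mat_hom n A \<in> Hom Ab (Zn_grp n) (Zn_grp n)"
proof -
  have *: "inj_on Vec_elt (carrier_vec n)" by (auto simp: inj_on_def)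
  have "restrict (\<lambda>x. Vec_elt (A *\<^sub>v the_vec x)) (carrier (Zn_grp n)) \<in> hom (Zn_grp n) (Zn_grp n)"
    using assms unfolding hom_def
    by (auto simp: Zn_grp_def image_group_def monoid_vec_simps inv_into_f_f[OF *]
        mult_add_distrib_mat_vec)
  then show ?thesis
    by (simp add: Hom_Ab mat_hom_def comm_group_Zn_grp)
qed

end

theory Submission
  imports Defs
begin

text \<open>
  A homomorphism \<open>\<beta> : \<int> \<rightarrow> \<int>\<^sup>n\<close> is a vector \<open>v\<close>, and \<open>f : G \<rightarrow> \<int>\<close> belongs to \<open>\<beta>\<^sup>*S\<close> exactly
  if, for some \<open>i\<close>, every diagonal entry \<open>d\<^sub>i\<^sub>j\<close> of \<open>A\<^sub>i\<close> divides \<open>f(x) v\<^sub>j\<close> for all \<open>x\<close>. This means that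
  all values of \<open>f\<close> are divisible by \<open>m\<^sub>i = lcm\<^sub>j (d\<^sub>i\<^sub>j / gcd (d\<^sub>i\<^sub>j, v\<^sub>j))\<close>. So \<open>\<beta>\<^sup>*S\<close> is the sieve on
  \<open>\<int>\<close> generated by the multiplications by the nonzero integers \<open>m\<^sub>i\<close>
  (\<open>pullback_generated_eq_div_sieve\<close>), and the heart of the proof is that such a sieve is a colim
  sieve if and only if the \<open>m\<^sub>i\<close> have greatest common divisor \<open>1\<close> (\<open>colim_div_sieve_iff\<close>).

  To see this, read the colimit condition as a gluing condition: each family of homomorphisms
  \<open>\<phi> f : G \<rightarrow> H\<close>, one for each \<open>f : G \<rightarrow> \<int>\<close> in the sieve and compatible with precomposition, comes from
  a unique \<open>w : \<int> \<rightarrow> H\<close> (\<open>colim_sieve_iff_amalgamation\<close>). Write \<open>x\<^sub>m \<in> H\<close> for the image of \<open>1\<close> under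
  the member of the family at multiplication by \<open>m\<close>. Gluing asks for a unique \<open>h = w(1)\<close> with
  \<open>m h = x\<^sub>m\<close> for all \<open>m\<close>. Compatibility gives \<open>m x\<^sub>k = k x\<^sub>m\<close>, so the integers \<open>k\<close> for which some \<open>h\<close>
  solves \<open>m h = k x\<^sub>m\<close> for all \<open>m\<close> form an ideal containing every \<open>m\<close>; if the greatest common divisor
  is \<open>1\<close>, then \<open>1\<close> is among them. Uniqueness holds because the integers at which two gluings agree also
  form an ideal containing every \<open>m\<close>. Conversely, if the
  greatest common divisor \<open>g\<close> is positive, then \<open>f \<mapsto> f / g\<close> is a compatible family with values in
  \<open>\<int>\<close>, and gluing it produces an integer \<open>t\<close> with \<open>t g = 1\<close>. If there are no \<open>m\<close> at all, the sieve is
  empty and gluings are not unique.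

  It remains to compare the \<open>m\<^sub>i\<close> with the determinants. For each \<open>v\<close>, \<open>m\<^sub>i\<close> divides the product
  \<open>det A\<^sub>i\<close> of the \<open>d\<^sub>i\<^sub>j\<close>, so determinants with greatest common divisor \<open>1\<close> make every \<open>\<beta>\<^sup>*S\<close> a colim sieve. If a prime divides all
  determinants, take \<open>v = (1, \<dots>, 1)\<close>: then \<open>m\<^sub>i\<close> is the least common multiple of the \<open>d\<^sub>i\<^sub>j\<close>, and
  the prime divides every \<open>m\<^sub>i\<close>.
\<close>

section \<open>Colim sieves through compatible families\<close>

definition compatible_family ::
  "('o, 'm) cat \<Rightarrow> 'm set \<Rightarrow> 'o \<Rightarrow> ('m \<Rightarrow> 'm) \<Rightarrow> bool" where
  "compatible_family C S Y \<phi> \<longleftrightarrow> Y \<in> Obs C \<and>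
     (\<forall>f \<in> S. \<phi> f \<in> Hom C (Dom C f) Y) \<and>
     (\<forall>f \<in> S. \<forall>k \<in> Ars C. Cod C k = Dom C f \<longrightarrow> \<phi> (Cmp C f k) = Cmp C (\<phi> f) k)"

text \<open>An arrow of the category of the sieve is determined by its target \<open>f\<close> and the precomposed
  arrow \<open>k\<close>, its source being \<open>f \<circ> k\<close>; hence naturality of a cocone is compatibility with
  precomposition.\<close>

lemma is_cocone_sieve_cat:
  assumes "category C" "is_sieve C X S"
  shows "is_cocone (sieve_cat C X S) C (forgetful C) Y \<phi> \<longleftrightarrow> compatible_family C S Y \<phi>"
proof -
  interpret category C by fact
  have S: "f \<in> Hom C (Dom C f) X" if "f \<in> S" for f
    using that assms(2) by (auto simp: is_sieve_def Hom_def)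
  have sub: "Cmp C f k \<in> S" "Dom C (Cmp C f k) = Dom C k" "Cod C (Cmp C f k) = X"
    "Cmp C f k \<in> Ars C"
    if "f \<in> S" "k \<in> Ars C" "Cod C k = Dom C f" for f k
    using that assms(2) Cmp_in[of k "Dom C k" "Dom C f" f X] S[OF that(1)]
    by (auto simp: is_sieve_def Hom_def)
  have ars: "Ars (sieve_cat C X S) =
      {(Cmp C f k, k, f) |f k. f \<in> S \<and> k \<in> Ars C \<and> Cod C k = Dom C f}"
    using S sub by (auto simp: sieve_cat_def full_subcat_def overcat_def Hom_def)
  have [simp]: "Obs (sieve_cat C X S) = S"
    "Dom (sieve_cat C X S) a = fst a" "Cod (sieve_cat C X S) a = snd (snd a)" for a
    by (auto simp: sieve_cat_def full_subcat_def overcat_def split: prod.splits)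
  show ?thesis
    unfolding is_cocone_def compatible_family_def ars by (fastforce simp: forgetful_def)
qed

text \<open>If \<open>colim\<^sub>S U\<close> is isomorphic to \<open>X\<close> by the canonical map, its universal property can be
  carried over to \<open>X\<close>, where it concerns the tautological cocone. So colim sieves are the sieves for
  which every representable presheaf satisfies the sheaf condition, and no colimit needs to be
  constructed to recognise one.\<close>

lemma colim_sieve_iff_amalgamation:
  assumes "category C" "is_sieve C X S"
  shows "colim_sieve C X S \<longleftrightarrow>
    (\<forall>Y \<phi>. compatible_family C S Y \<phi> \<longrightarrow> (\<exists>!w. w \<in> Hom C X Y \<and> (\<forall>f \<in> S. Cmp C w f = \<phi> f)))"
    (is "_ \<longleftrightarrow> ?amalg")
proof -
  interpret category C by fact
  have X: "X \<in> Obs C" and S: "\<And>f. f \<in> S \<Longrightarrow> f \<in> Hom C (Dom C f) X"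
    using assms(2) by (auto simp: is_sieve_def Hom_def)
  have obs: "Obs (sieve_cat C X S) = S" by (simp add: sieve_cat_def full_subcat_def)
  have colim: "is_colimit (sieve_cat C X S) C (forgetful C) c \<iota> \<longleftrightarrow> compatible_family C S c \<iota> \<and>
     (\<forall>Y \<phi>. compatible_family C S Y \<phi> \<longrightarrow> (\<exists>!w. w \<in> Hom C c Y \<and> (\<forall>f \<in> S. Cmp C w (\<iota> f) = \<phi> f)))"
    for c \<iota>
    by (simp add: is_colimit_def is_cocone_sieve_cat[OF assms] obs)
  show ?thesis
  proof
    \<comment> \<open>Transport along \<open>v = u\<inverse>\<close>, which carries the tautological cocone back to \<open>\<iota>\<close>.\<close>
    assume "colim_sieve C X S"
    then obtain c \<iota> u where c: "compatible_family C S c \<iota>"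
      and univ: "\<And>Y \<phi>. compatible_family C S Y \<phi> \<Longrightarrow>
        \<exists>!w. w \<in> Hom C c Y \<and> (\<forall>f \<in> S. Cmp C w (\<iota> f) = \<phi> f)"
      and u: "u \<in> Hom C c X" "\<And>f. f \<in> S \<Longrightarrow> Cmp C u (\<iota> f) = f" "is_iso C u"
      unfolding colim_sieve_def colim by blast
    have \<iota>: "\<iota> f \<in> Hom C (Dom C f) c" if "f \<in> S" for f
      using c that by (simp add: compatible_family_def)
    obtain v where v: "v \<in> Hom C X c" "Cmp C v u = Idn C c" "Cmp C u v = Idn C X"
      using u(1,3) by (auto simp: is_iso_def Hom_def)
    have v\<iota>: "Cmp C v f = \<iota> f" if "f \<in> S" for f
      using Cmp_assoc[OF \<iota>[OF that] u(1) v(1)] u(2)[OF that] v(2) Idn_left[OF \<iota>[OF that]] by simp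
    show ?amalg
    proof (intro allI impI)
      fix Y \<phi> assume "compatible_family C S Y \<phi>"
      from univ[OF this] obtain t where t: "t \<in> Hom C c Y" "\<forall>f \<in> S. Cmp C t (\<iota> f) = \<phi> f"
        and uniq: "\<And>s. s \<in> Hom C c Y \<Longrightarrow> \<forall>f \<in> S. Cmp C s (\<iota> f) = \<phi> f \<Longrightarrow> s = t" by blast
      show "\<exists>!w. w \<in> Hom C X Y \<and> (\<forall>f \<in> S. Cmp C w f = \<phi> f)"
      proof (intro ex1I conjI ballI)
        show "Cmp C t v \<in> Hom C X Y" by (rule Cmp_in[OF v(1) t(1)])
        show "Cmp C (Cmp C t v) f = \<phi> f" if "f \<in> S" for f
          using Cmp_assoc[OF S[OF that] v(1) t(1)] v\<iota>[OF that] t(2) that by simp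
      next
        fix w assume w: "w \<in> Hom C X Y \<and> (\<forall>f \<in> S. Cmp C w f = \<phi> f)"
        have "Cmp C w u = t"
        proof (rule uniq)
          show "Cmp C w u \<in> Hom C c Y" using Cmp_in[OF u(1)] w by blast
          show "\<forall>f \<in> S. Cmp C (Cmp C w u) (\<iota> f) = \<phi> f"
            using Cmp_assoc[OF \<iota> u(1), of _ w Y] u(2) w by simp
        qed
        then show "w = Cmp C t v"
          using Cmp_assoc[OF v(1) u(1), of w Y] v(3) Idn_right[of w X Y] w by simp
      qed
    qed
  next
    assume amalg: ?amalg
    have "compatible_family C S X (\<lambda>f. f)"
      using X S by (simp add: compatible_family_def)
    then have "is_colimit (sieve_cat C X S) C (forgetful C) X (\<lambda>f. f)"
      using amalg unfolding colim by blast
    moreover have "is_iso C (Idn C X)" "Idn C X \<in> Hom C X X"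
      using Idn_in[OF X] Idn_left[OF Idn_in[OF X]] by (auto simp: is_iso_def Hom_def)
    moreover have "\<forall>f \<in> S. Cmp C (Idn C X) f = f" using S Idn_left by blast
    ultimately show "colim_sieve C X S"
      using assms(2) unfolding colim_sieve_def by blast
  qed
qed

section \<open>Homomorphisms into and out of the integers\<close>

definition the_int :: "'u elt \<Rightarrow> int" where
  "the_int = inv_into UNIV Int_elt"

lemma the_int_Int_elt [simp]: "the_int (Int_elt k) = k"
  by (simp add: the_int_def inj_def)

lemma carrier_Z_grp: "carrier Z_grp = range Int_elt"
  by (simp add: Z_grp_def image_group_def)

lemma Int_elt_in_Z_grp [simp]: "Int_elt k \<in> carrier Z_grp"
  by (simp add: carrier_Z_grp)

lemma Int_elt_the_int [simp]: "x \<in> carrier Z_grp \<Longrightarrow> Int_elt (the_int x) = x"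
  by (auto simp: carrier_Z_grp)

lemma mult_Z_grp [simp]: "Int_elt a \<otimes>\<^bsub>Z_grp\<^esub> Int_elt b = Int_elt (a + b)"
  by (simp add: Z_grp_def image_group_def inj_def)

lemma the_int_mult_Z_grp:
  "\<lbrakk>x \<in> carrier Z_grp; y \<in> carrier Z_grp\<rbrakk> \<Longrightarrow> the_int (x \<otimes>\<^bsub>Z_grp\<^esub> y) = the_int x + the_int y"
  by (auto simp: carrier_Z_grp)

lemma int_pow_Z_grp [simp]:
  "(Int_elt a :: 'u elt) [^]\<^bsub>Z_grp\<^esub> (k::int) = Int_elt (k * a)"
proof -
  have "(Int_elt :: int \<Rightarrow> 'u elt) \<in> hom integer_group Z_grp" by (simp add: hom_def)
  from hom_int_pow[OF this _ group_integer_group comm_group.axioms(2)[OF comm_group_Z_grp], of a k]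
  show ?thesis by simp
qed

lemma carrier_Zn_grp: "carrier (Zn_grp n) = Vec_elt ` carrier_vec n"
  by (simp add: Zn_grp_def image_group_def monoid_vec_simps)

lemma mult_Zn_grp:
  assumes "v \<in> carrier_vec n" "w \<in> carrier_vec n"
  shows "(Vec_elt v :: 'u elt) \<otimes>\<^bsub>Zn_grp n\<^esub> Vec_elt w = Vec_elt (v + w)"
proof -
  have "inj_on (Vec_elt :: int vec \<Rightarrow> 'u elt) (carrier_vec n)" by (simp add: inj_on_def)
  then show ?thesis
    using assms by (simp add: Zn_grp_def image_group_def monoid_vec_simps inv_into_f_f)
qed

lemma Ab_simps [simp]: "Dom Ab = src" "Cod Ab = tgt" "Obs Ab = {G. comm_group G}"
  by (simp_all add: Ab_def)

lemma Cmp_Ab_apply: "x \<in> carrier (src f) \<Longrightarrow> fn (Cmp Ab g f) x = fn g (fn f x)"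
  by (simp add: Ab_def compose_def)

lemma Hom_src: "\<lbrakk>f \<in> Ars Ab; tgt f = H\<rbrakk> \<Longrightarrow> f \<in> Hom Ab (src f) H"
  by (simp add: Hom_def)

lemma Hom_AbD:
  assumes "f \<in> Hom Ab G H"
  shows "src f = G" "tgt f = H" "comm_group G" "comm_group H" "group G" "group H"
    "fn f \<in> hom G H" "f \<in> Ars Ab"
    "x \<in> carrier G \<Longrightarrow> fn f x \<in> carrier H"
    "x \<in> carrier G \<Longrightarrow> y \<in> carrier G \<Longrightarrow> fn f (x \<otimes>\<^bsub>G\<^esub> y) = fn f x \<otimes>\<^bsub>H\<^esub> fn f y"
    "x \<in> carrier G \<Longrightarrow> fn f (x [^]\<^bsub>G\<^esub> (k::int)) = fn f x [^]\<^bsub>H\<^esub> k"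
proof -
  show "src f = G" "tgt f = H" and GH: "comm_group G" "comm_group H" and h: "fn f \<in> hom G H"
    and "f \<in> Ars Ab"
    using assms by (auto simp: Hom_Ab Hom_def Ab_def)
  show G: "group G" "group H" using GH by (simp_all add: comm_group.axioms(2))
  show "x \<in> carrier G \<Longrightarrow> fn f (x [^]\<^bsub>G\<^esub> (k::int)) = fn f x [^]\<^bsub>H\<^esub> k"
    using hom_int_pow[OF h _ G] by blast
qed (use assms in \<open>auto simp: Hom_Ab hom_def\<close>)

lemma Hom_Ab_eqI:
  assumes "f \<in> Hom Ab G H" "g \<in> Hom Ab G H" "\<And>x. x \<in> carrier G \<Longrightarrow> fn f x = fn g x"
  shows "f = g"
  using assms by (auto simp: Hom_Ab intro: extensionalityI)

lemma Cmp_Ab_in: "\<lbrakk>f \<in> Hom Ab X Y; g \<in> Hom Ab Y Z\<rbrakk> \<Longrightarrow> Cmp Ab g f \<in> Hom Ab X Z"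
  by (rule category.Cmp_in[OF category_Ab])

text \<open>Since \<open>\<int>\<close> is free on \<open>1\<close>, these are all the homomorphisms out of it. For \<open>H = \<int>\<close> and
  \<open>h = m\<close> the homomorphism is multiplication by \<open>m\<close>.\<close>

definition power_hom :: "'u elt monoid \<Rightarrow> 'u elt \<Rightarrow> 'u elt ab_hom" where
  "power_hom H h = AbHom Z_grp (restrict (\<lambda>x. h [^]\<^bsub>H\<^esub> the_int x) (carrier Z_grp)) H"

lemma src_power_hom [simp]: "src (power_hom H h) = Z_grp"
  and tgt_power_hom [simp]: "tgt (power_hom H h) = H"
  by (simp_all add: power_hom_def)

lemma power_hom_apply [simp]: "fn (power_hom H h) (Int_elt k) = h [^]\<^bsub>H\<^esub> k"
  by (simp add: power_hom_def)

lemma power_hom_in_Hom: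
  assumes "comm_group H" "h \<in> carrier H"
  shows "power_hom H h \<in> Hom Ab Z_grp H"
proof -
  interpret comm_group H by fact
  show ?thesis
    using assms int_pow_mult
    by (auto simp: Hom_Ab power_hom_def comm_group_Z_grp hom_def carrier_Z_grp)
qed

lemma Hom_from_Z_apply:
  assumes "w \<in> Hom Ab Z_grp H"
  shows "fn w (Int_elt k) = fn w (Int_elt 1) [^]\<^bsub>H\<^esub> k"
  using Hom_AbD(11)[OF assms, of "Int_elt 1" k] by simp

lemma Hom_from_Z_eqI:
  assumes "f \<in> Hom Ab Z_grp H" "g \<in> Hom Ab Z_grp H" "fn f (Int_elt 1) = fn g (Int_elt 1)"
  shows "f = g"
proof (rule Hom_Ab_eqI[OF assms(1,2)])
  show "fn f x = fn g x" if x: "x \<in> carrier Z_grp" for x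
    using Hom_from_Z_apply[OF assms(1), of "the_int x"] Hom_from_Z_apply[OF assms(2), of "the_int x"]
      assms(3) x by simp
qed

definition hom_to_Z :: "'u elt monoid \<Rightarrow> ('u elt \<Rightarrow> int) \<Rightarrow> 'u elt ab_hom" where
  "hom_to_Z G \<phi> = AbHom G (restrict (\<lambda>x. Int_elt (\<phi> x)) (carrier G)) Z_grp"

lemma hom_to_Z_apply [simp]: "x \<in> carrier G \<Longrightarrow> fn (hom_to_Z G \<phi>) x = Int_elt (\<phi> x)"
  by (simp add: hom_to_Z_def)

lemma hom_to_Z_in_Hom:
  assumes "comm_group G"
    and "\<And>x y. \<lbrakk>x \<in> carrier G; y \<in> carrier G\<rbrakk> \<Longrightarrow> \<phi> (x \<otimes>\<^bsub>G\<^esub> y) = \<phi> x + \<phi> y"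
  shows "hom_to_Z G \<phi> \<in> Hom Ab G Z_grp"
proof -
  interpret comm_group G by fact
  show ?thesis
    using assms by (auto simp: Hom_Ab hom_to_Z_def comm_group_Z_grp hom_def)
qed

definition hom_to_Zn :: "nat \<Rightarrow> 'u elt monoid \<Rightarrow> ('u elt \<Rightarrow> nat \<Rightarrow> int) \<Rightarrow> 'u elt ab_hom" where
  "hom_to_Zn n G \<phi> = AbHom G (restrict (\<lambda>x. Vec_elt (vec n (\<phi> x))) (carrier G)) (Zn_grp n)"

lemma hom_to_Zn_apply [simp]: "x \<in> carrier G \<Longrightarrow> fn (hom_to_Zn n G \<phi>) x = Vec_elt (vec n (\<phi> x))"
  by (simp add: hom_to_Zn_def)

lemma hom_to_Zn_in_Hom:
  assumes "comm_group G"
    and "\<And>x y j. \<lbrakk>x \<in> carrier G; y \<in> carrier G; j < n\<rbrakk> \<Longrightarrow> \<phi> (x \<otimes>\<^bsub>G\<^esub> y) j = \<phi> x j + \<phi> y j"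
  shows "hom_to_Zn n G \<phi> \<in> Hom Ab G (Zn_grp n)"
proof -
  interpret comm_group G by fact
  have "vec n (\<phi> (x \<otimes>\<^bsub>G\<^esub> y)) = vec n (\<phi> x) + vec n (\<phi> y)"
    if "x \<in> carrier G" "y \<in> carrier G" for x y
    using assms(2)[OF that] by auto
  then show ?thesis
    using assms(1)
    by (auto simp: Hom_Ab hom_to_Zn_def comm_group_Zn_grp hom_def carrier_Zn_grp mult_Zn_grp)
qed

lemma the_int_fn_mult:
  assumes "f \<in> Hom Ab G Z_grp" "x \<in> carrier G" "y \<in> carrier G"
  shows "the_int (fn f (x \<otimes>\<^bsub>G\<^esub> y)) = the_int (fn f x) + the_int (fn f y)"
  using Hom_AbD(9,10)[OF assms(1)] assms(2,3) by (simp add: the_int_mult_Z_grp)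

lemma the_vec_fn_mult:
  assumes "f \<in> Hom Ab G (Zn_grp n)" "x \<in> carrier G" "y \<in> carrier G" "j < n"
  shows "the_vec (fn f (x \<otimes>\<^bsub>G\<^esub> y)) $ j = the_vec (fn f x) $ j + the_vec (fn f y) $ j"
proof -
  obtain v w where "fn f x = Vec_elt v" "fn f y = Vec_elt w" "v \<in> carrier_vec n" "w \<in> carrier_vec n"
    using Hom_AbD(9)[OF assms(1)] assms(2,3) unfolding carrier_Zn_grp by blast
  then show ?thesis
    using Hom_AbD(10)[OF assms(1-3)] assms(4) by (simp add: mult_Zn_grp)
qed

section \<open>Sieves on the integers given by divisibility\<close>

text \<open>This is the sieve generated by the multiplications by the elements of \<open>M\<close>.
  The description by divisibility of values spares the choice of a factorisation.\<close>

definition div_sieve :: "int set \<Rightarrow> 'u elt ab_hom set" where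
  "div_sieve M = {f \<in> Ars Ab. tgt f = Z_grp \<and>
     (\<exists>m \<in> M. \<forall>x \<in> carrier (src f). m dvd the_int (fn f x))}"

lemma is_sieve_div_sieve: "is_sieve Ab Z_grp (div_sieve M)"
proof -
  have "Cmp Ab f g \<in> div_sieve M"
    if f: "f \<in> div_sieve M" and g: "g \<in> Ars Ab" "tgt g = src f" for f g :: "'a elt ab_hom"
  proof -
    have *: "f \<in> Hom Ab (src f) Z_grp" using f by (simp add: div_sieve_def Hom_src)
    have g': "g \<in> Hom Ab (src g) (src f)" using g by (simp add: Hom_src)
    have "Cmp Ab f g \<in> Hom Ab (src g) Z_grp" by (rule Cmp_Ab_in[OF g' *])
    moreover obtain m where "m \<in> M" "\<forall>x \<in> carrier (src f). m dvd the_int (fn f x)"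
      using f by (auto simp: div_sieve_def)
    ultimately show ?thesis
      using Hom_AbD(9)[OF g'] by (auto simp: div_sieve_def Hom_def Cmp_Ab_apply)
  qed
  then show ?thesis
    using comm_group_Z_grp by (auto simp: is_sieve_def div_sieve_def)
qed

lemma mem_div_sieve:
  assumes "f \<in> Hom Ab G Z_grp" "m \<in> M" "\<And>x. x \<in> carrier G \<Longrightarrow> m dvd the_int (fn f x)"
  shows "f \<in> div_sieve M"
  using assms by (auto simp: div_sieve_def Hom_def)

text \<open>Bezout's identity in the form used below, both for uniqueness and for existence of gluings: a
  condition on integers that cuts out an ideal and holds on \<open>M\<close> holds at \<open>Gcd M\<close>.\<close>

lemma Gcd_in_ideal:
  fixes M I :: "int set"
  assumes "finite M" "M \<subseteq> I" "0 \<in> I"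
    and add: "\<And>a b. \<lbrakk>a \<in> I; b \<in> I\<rbrakk> \<Longrightarrow> a + b \<in> I" and mult: "\<And>a k. a \<in> I \<Longrightarrow> k * a \<in> I"
  shows "Gcd M \<in> I"
  using assms(1,2)
proof (induction M rule: finite_induct)
  case empty
  then show ?case using assms(3) by simp
next
  case (insert m M)
  obtain u v where "u * m + v * Gcd M = gcd m (Gcd M)" using bezout_int by blast
  moreover have "u * m + v * Gcd M \<in> I" using insert by (intro add mult) auto
  ultimately show ?case by simp
qed

lemma mul_in_Hom: "power_hom Z_grp (Int_elt m) \<in> Hom Ab Z_grp Z_grp"
  by (simp add: power_hom_in_Hom comm_group_Z_grp)

lemma mul_in_div_sieve: "m \<in> M \<Longrightarrow> power_hom Z_grp (Int_elt m) \<in> div_sieve M"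
  by (rule mem_div_sieve[OF mul_in_Hom]) (auto simp: carrier_Z_grp)

lemma amalgamation_unique:
  fixes w w' :: "'u elt ab_hom"
  assumes M: "finite M" "Gcd M = 1"
    and w: "w \<in> Hom Ab Z_grp H" "w' \<in> Hom Ab Z_grp H"
    and eq: "\<And>f. f \<in> div_sieve M \<Longrightarrow> Cmp Ab w f = Cmp Ab w' f"
  shows "w = w'"
proof -
  interpret comm_group H using Hom_AbD(4)[OF w(1)] .
  define I where "I = {k. fn w (Int_elt k) = fn w' (Int_elt k)}"
  have "Gcd M \<in> I"
  proof (rule Gcd_in_ideal[OF M(1)])
    show "M \<subseteq> I"
    proof
      fix m assume "m \<in> M"
      let ?f = "power_hom (Z_grp :: 'u elt monoid) (Int_elt m)"
      have "fn (Cmp Ab w ?f) (Int_elt 1) = fn (Cmp Ab w' ?f) (Int_elt 1)"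
        using eq[OF mul_in_div_sieve[OF \<open>m \<in> M\<close>]] by simp
      then show "m \<in> I"
        by (simp add: Cmp_Ab_apply I_def)
    qed
    show "0 \<in> I"
      using Hom_from_Z_apply[OF w(1), of 0] Hom_from_Z_apply[OF w(2), of 0] by (simp add: I_def)
    show "a + b \<in> I" if "a \<in> I" "b \<in> I" for a b
      using that Hom_AbD(10)[OF w(1), of "Int_elt a" "Int_elt b"]
        Hom_AbD(10)[OF w(2), of "Int_elt a" "Int_elt b"] by (simp add: I_def)
    show "k * a \<in> I" if "a \<in> I" for a k
      using that Hom_AbD(11)[OF w(1), of "Int_elt a" k] Hom_AbD(11)[OF w(2), of "Int_elt a" k]
      by (simp add: I_def)
  qed
  then show ?thesis
    using Hom_from_Z_eqI[OF w] M(2) by (simp add: I_def)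
qed

text \<open>The multiplications by \<open>m \<in> M\<close> generate the sieve, so a gluing only has to be right on them.
  Let \<open>x m\<close> be the value at \<open>1\<close> of the family at multiplication by \<open>m\<close>. In multiplicative notation,
  an element \<open>h\<close> with \<open>h [^] m = x m\<close> for all \<open>m\<close> is needed; it is found by applying Bezout's identity
  to the exponents \<open>k\<close> for which some \<open>h\<close> satisfies \<open>h [^] m = x m [^] k\<close> for all \<open>m\<close>.\<close>

lemma amalgamation_exists:
  fixes H :: "'u elt monoid"
  assumes M: "finite M" "0 \<notin> M" "Gcd M = 1"
    and \<phi>: "compatible_family Ab (div_sieve M) H \<phi>"
  shows "\<exists>w \<in> Hom Ab Z_grp H. \<forall>f \<in> div_sieve M. Cmp Ab w f = \<phi> f"
proof -
  have H: "comm_group H"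
    and \<phi>_hom: "\<And>f. f \<in> div_sieve M \<Longrightarrow> \<phi> f \<in> Hom Ab (src f) H"
    and \<phi>_comp: "\<And>f k. \<lbrakk>f \<in> div_sieve M; k \<in> Ars Ab; tgt k = src f\<rbrakk> \<Longrightarrow>
      \<phi> (Cmp Ab f k) = Cmp Ab (\<phi> f) k"
    using \<phi> by (auto simp: compatible_family_def)
  interpret comm_group H by fact
  let ?mul = "\<lambda>m. power_hom (Z_grp :: 'u elt monoid) (Int_elt m)"
  have mul_Ars [simp]: "?mul m \<in> Ars Ab" for m
    by (rule Hom_AbD(8)[OF mul_in_Hom])
  define x where "x m = fn (\<phi> (?mul m)) (Int_elt 1)" for m
  have \<phi>_mul: "\<phi> (?mul m) \<in> Hom Ab Z_grp H" if "m \<in> M" for m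
    using \<phi>_hom[OF mul_in_div_sieve[OF that]] by simp
  have x: "x m \<in> carrier H" if "m \<in> M" for m
    using Hom_AbD(9)[OF \<phi>_mul[OF that]] by (simp add: x_def)
  have x_pow: "fn (\<phi> (?mul m)) (Int_elt k) = x m [^]\<^bsub>H\<^esub> k" if "m \<in> M" for m k
    using Hom_from_Z_apply[OF \<phi>_mul[OF that], of k] by (simp add: x_def)
  have mul_comm: "Cmp Ab (?mul a) (?mul b) = Cmp Ab (?mul b) (?mul a)" for a b
    by (rule Hom_from_Z_eqI) (auto intro!: Cmp_Ab_in mul_in_Hom simp: Cmp_Ab_apply)
  \<comment> \<open>Both sides are the value at \<open>1\<close> of the family at multiplication by \<open>a b\<close>.\<close>
  have swap: "x a [^]\<^bsub>H\<^esub> b = x b [^]\<^bsub>H\<^esub> a" if ab: "a \<in> M" "b \<in> M" for a b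
  proof -
    have "Cmp Ab (\<phi> (?mul a)) (?mul b) = Cmp Ab (\<phi> (?mul b)) (?mul a)"
      using \<phi>_comp[OF mul_in_div_sieve[OF ab(1)], of "?mul b"]
        \<phi>_comp[OF mul_in_div_sieve[OF ab(2)], of "?mul a"] mul_comm by simp
    then have "fn (Cmp Ab (\<phi> (?mul a)) (?mul b)) (Int_elt 1) =
        fn (Cmp Ab (\<phi> (?mul b)) (?mul a)) (Int_elt 1)" by simp
    then show ?thesis using ab by (simp add: Cmp_Ab_apply x_pow)
  qed
  define I :: "int set" where "I = {k. \<exists>h \<in> carrier H. \<forall>m \<in> M. h [^]\<^bsub>H\<^esub> m = x m [^]\<^bsub>H\<^esub> k}"
  have "Gcd M \<in> I"
  proof (rule Gcd_in_ideal[OF M(1)])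
    \<comment> \<open>By \<open>swap\<close>, the exponent \<open>a \<in> M\<close> is witnessed by \<open>h = x a\<close>.\<close>
    show "M \<subseteq> I"
      using swap x by (auto simp: I_def)
    show "0 \<in> I" by (auto simp: I_def intro!: bexI[of _ "\<one>\<^bsub>H\<^esub>"])
    show "a + b \<in> I" if "a \<in> I" "b \<in> I" for a b
    proof -
      obtain h h' where "h \<in> carrier H" "\<forall>m \<in> M. h [^]\<^bsub>H\<^esub> m = x m [^]\<^bsub>H\<^esub> a"
        "h' \<in> carrier H" "\<forall>m \<in> M. h' [^]\<^bsub>H\<^esub> m = x m [^]\<^bsub>H\<^esub> b"
        using \<open>a \<in> I\<close> \<open>b \<in> I\<close> unfolding I_def by blast
      then show ?thesis
        using x by (auto simp: I_def int_pow_distrib int_pow_mult intro!: bexI[of _ "h \<otimes>\<^bsub>H\<^esub> h'"])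
    qed
    show "k * a \<in> I" if "a \<in> I" for a k
    proof -
      obtain h where h: "h \<in> carrier H" "\<forall>m \<in> M. h [^]\<^bsub>H\<^esub> m = x m [^]\<^bsub>H\<^esub> a"
        using \<open>a \<in> I\<close> unfolding I_def by blast
      have "(h [^]\<^bsub>H\<^esub> k) [^]\<^bsub>H\<^esub> m = x m [^]\<^bsub>H\<^esub> (k * a)" if "m \<in> M" for m
      proof -
        have "(h [^]\<^bsub>H\<^esub> k) [^]\<^bsub>H\<^esub> m = (h [^]\<^bsub>H\<^esub> m) [^]\<^bsub>H\<^esub> k"
          using h(1) by (simp only: int_pow_pow mult.commute)
        also have "\<dots> = (x m [^]\<^bsub>H\<^esub> a) [^]\<^bsub>H\<^esub> k" using h(2) that by metis
        also have "\<dots> = x m [^]\<^bsub>H\<^esub> (k * a)" using x[OF that] by (simp only: int_pow_pow mult.commute)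
        finally show ?thesis .
      qed
      then show ?thesis using h(1) by (auto simp: I_def intro!: bexI[of _ "h [^]\<^bsub>H\<^esub> k"])
    qed
  qed
  then obtain h where h: "h \<in> carrier H" "\<And>m. m \<in> M \<Longrightarrow> h [^]\<^bsub>H\<^esub> m = x m"
    using M(3) x by (auto simp: I_def)
  show ?thesis
  proof (intro bexI ballI)
    show w: "power_hom H h \<in> Hom Ab Z_grp H" by (rule power_hom_in_Hom[OF H h(1)])
    fix f :: "'u elt ab_hom" assume f: "f \<in> div_sieve M"
    then obtain m where m: "m \<in> M" "\<And>y. y \<in> carrier (src f) \<Longrightarrow> m dvd the_int (fn f y)"
      and f': "f \<in> Hom Ab (src f) Z_grp"
      by (auto simp: div_sieve_def Hom_src)
    have "m \<noteq> 0" using m(1) M(2) by blast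
    \<comment> \<open>\<open>f\<close> is multiplication by \<open>m\<close> after \<open>t\<close>, so compatibility determines \<open>\<phi> f\<close>.\<close>
    define t where "t = hom_to_Z (src f) (\<lambda>y. the_int (fn f y) div m)"
    have t: "t \<in> Hom Ab (src f) Z_grp"
      unfolding t_def
    proof (rule hom_to_Z_in_Hom)
      show "comm_group (src f)" using Hom_AbD(3)[OF f'] .
      show "the_int (fn f (y \<otimes>\<^bsub>src f\<^esub> z)) div m = the_int (fn f y) div m + the_int (fn f z) div m"
        if "y \<in> carrier (src f)" "z \<in> carrier (src f)" for y z
        using the_int_fn_mult[OF f' that] m(2)[OF that(1)] by (simp add: div_plus_div_distrib_dvd_left)
    qed
    have t_app: "fn t y = Int_elt (the_int (fn f y) div m)" if "y \<in> carrier (src f)" for y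
      using that by (simp add: t_def)
    have src_t: "src t = src f" "tgt t = Z_grp" "t \<in> Ars Ab" using t by (auto simp: Hom_def)
    have "f = Cmp Ab (?mul m) t"
      using m(2) by (intro Hom_Ab_eqI[OF f' Cmp_Ab_in[OF t mul_in_Hom]])
        (simp add: Cmp_Ab_apply src_t t_app Hom_AbD(9)[OF f'])
    then have \<phi>f: "\<phi> f = Cmp Ab (\<phi> (?mul m)) t"
      using \<phi>_comp[OF mul_in_div_sieve[OF m(1)], of t] src_t by simp
    show "Cmp Ab (power_hom H h) f = \<phi> f"
    proof (rule Hom_Ab_eqI[OF Cmp_Ab_in[OF f' w] \<phi>_hom[OF f]])
      fix y assume y: "y \<in> carrier (src f)"
      have "fn (power_hom H h) (fn f y) = h [^]\<^bsub>H\<^esub> the_int (fn f y)"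
        using power_hom_apply[of H h "the_int (fn f y)"] Hom_AbD(9)[OF f' y] by simp
      also have "\<dots> = (h [^]\<^bsub>H\<^esub> m) [^]\<^bsub>H\<^esub> (the_int (fn f y) div m)"
        using m(2)[OF y] h(1) by (simp add: int_pow_pow)
      also have "\<dots> = fn (\<phi> f) y"
        using y m(1) h(2) by (simp add: \<phi>f Cmp_Ab_apply src_t t_app x_pow)
      finally show "fn (Cmp Ab (power_hom H h) f) y = fn (\<phi> f) y"
        using y by (simp add: Cmp_Ab_apply)
    qed
  qed
qed

text \<open>All arrows of the sieve have values divisible by \<open>g = Gcd M\<close>, and dividing them by \<open>g\<close> is
  compatible with precomposition. A gluing of the quotients would be division by \<open>g\<close> on \<open>\<int>\<close>, which
  forces \<open>g = 1\<close>. This needs \<open>g \<noteq> 0\<close>; the exception \<open>M = {}\<close> gives the empty sieve, for which gluings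
  of the empty family are not unique.\<close>

lemma colim_div_sieve_imp_Gcd:
  fixes M :: "int set"
  assumes M: "0 \<notin> M" and colim: "colim_sieve Ab (Z_grp :: 'u elt monoid) (div_sieve M)"
  shows "Gcd M = 1"
proof -
  let ?Z = "Z_grp :: 'u elt monoid"
  have amalg: "\<exists>!w. w \<in> Hom Ab ?Z Y \<and> (\<forall>f \<in> div_sieve M. Cmp Ab w f = \<phi> f)"
    if "compatible_family Ab (div_sieve M) Y \<phi>" for Y \<phi>
    using colim that colim_sieve_iff_amalgamation[OF category_Ab is_sieve_div_sieve] by blast
  show ?thesis
  proof (cases "M = {}")
    case True
    then have "div_sieve M = ({} :: 'u elt ab_hom set)" by (simp add: div_sieve_def)
    then have "\<exists>!w. w \<in> Hom Ab ?Z ?Z"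
      using amalg[of ?Z "\<lambda>f. f"] comm_group_Z_grp by (simp add: compatible_family_def)
    then have "power_hom ?Z (Int_elt 0) = power_hom ?Z (Int_elt 1)"
      using mul_in_Hom by blast
    then have "fn (power_hom ?Z (Int_elt 0)) (Int_elt 1) = fn (power_hom ?Z (Int_elt 1)) (Int_elt 1)"
      by simp
    then show ?thesis by simp
  next
    case False
    then obtain m where m: "m \<in> M" "m \<noteq> 0" using M by blast
    define g where "g = Gcd M"
    have "g dvd m" using m(1) by (simp add: g_def)
    then have "g \<noteq> 0" using m(2) by auto
    moreover have "g \<ge> 0" by (simp add: g_def)
    ultimately have g: "g > 0" by simp
    define \<phi> :: "'u elt ab_hom \<Rightarrow> 'u elt ab_hom"
      where "\<phi> f = hom_to_Z (src f) (\<lambda>y. the_int (fn f y) div g)" for f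
    have f: "f \<in> Hom Ab (src f) Z_grp"
      and gdvd: "\<And>y. y \<in> carrier (src f) \<Longrightarrow> g dvd the_int (fn f y)"
      if "f \<in> div_sieve M" for f :: "'u elt ab_hom"
      using that by (auto simp: div_sieve_def Hom_src g_def intro: dvd_trans[OF Gcd_dvd])
    have \<phi>_hom: "\<phi> f \<in> Hom Ab (src f) Z_grp" if fS: "f \<in> div_sieve M" for f
      unfolding \<phi>_def
    proof (rule hom_to_Z_in_Hom)
      show "comm_group (src f)" using Hom_AbD(3)[OF f[OF fS]] .
      show "the_int (fn f (y \<otimes>\<^bsub>src f\<^esub> z)) div g = the_int (fn f y) div g + the_int (fn f z) div g"
        if "y \<in> carrier (src f)" "z \<in> carrier (src f)" for y z
        using the_int_fn_mult[OF f[OF fS] that] gdvd[OF fS that(1)]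
        by (simp add: div_plus_div_distrib_dvd_left)
    qed
    have "\<phi> (Cmp Ab f k) = Cmp Ab (\<phi> f) k"
      if fS: "f \<in> div_sieve M" and k: "k \<in> Ars Ab" "tgt k = src f" for f k
    proof -
      have k': "k \<in> Hom Ab (src k) (src f)" using k by (simp add: Hom_src)
      have fk: "Cmp Ab f k \<in> div_sieve M"
        using is_sieve_div_sieve[of M] fS k by (auto simp: is_sieve_def)
      have src: "src (Cmp Ab f k) = src k" using Hom_AbD(1)[OF Cmp_Ab_in[OF k' f[OF fS]]] .
      show ?thesis
        by (rule Hom_Ab_eqI[OF \<phi>_hom[OF fk, unfolded src] Cmp_Ab_in[OF k' \<phi>_hom[OF fS]]])
          (simp add: \<phi>_def src Cmp_Ab_apply Hom_AbD(9)[OF k'])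
    qed
    then have "compatible_family Ab (div_sieve M) ?Z \<phi>"
      using \<phi>_hom comm_group_Z_grp by (simp add: compatible_family_def)
    from amalg[OF this] obtain w where w: "w \<in> Hom Ab ?Z ?Z"
      "\<And>f. f \<in> div_sieve M \<Longrightarrow> Cmp Ab w f = \<phi> f" by blast
    obtain t where t: "fn w (Int_elt 1) = Int_elt t"
      using Hom_AbD(9)[OF w(1), of "Int_elt 1"] by (auto simp: carrier_Z_grp)
    let ?f = "power_hom ?Z (Int_elt m)"
    have "fn (Cmp Ab w ?f) (Int_elt 1) = fn (\<phi> ?f) (Int_elt 1)"
      using w(2)[OF mul_in_div_sieve[OF m(1)]] by simp
    then have "m * t = m div g"
      using Hom_from_Z_apply[OF w(1), of m] by (simp add: Cmp_Ab_apply t \<phi>_def)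
    then have "m * (t * g) = m"
      using \<open>g dvd m\<close> by (metis dvd_div_mult_self mult.assoc)
    then have "t * g = 1" using m(2) by simp
    then show ?thesis using g by (simp add: g_def[symmetric] zmult_eq_1_iff)
  qed
qed

lemma colim_div_sieve_iff:
  assumes "finite M" "0 \<notin> M"
  shows "colim_sieve Ab (Z_grp :: 'u elt monoid) (div_sieve M) \<longleftrightarrow> Gcd M = 1"
proof
  assume gcd: "Gcd M = 1"
  show "colim_sieve Ab (Z_grp :: 'u elt monoid) (div_sieve M)"
    unfolding colim_sieve_iff_amalgamation[OF category_Ab is_sieve_div_sieve]
    using amalgamation_exists[OF assms gcd] amalgamation_unique[OF assms(1) gcd] by metis
qed (rule colim_div_sieve_imp_Gcd[OF assms(2)])

section \<open>Pulling back along a homomorphism from the integers\<close>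

text \<open>The integers \<open>k\<close> with \<open>d j dvd k * v j\<close> for all \<open>j\<close> form an ideal; \<open>m\<close> is a generator. It
  divides the product of the \<open>d j\<close> because the product lies in that ideal.\<close>

lemma simultaneous_divisor:
  fixes d v :: "nat \<Rightarrow> int"
  assumes "\<And>j. j < n \<Longrightarrow> d j \<noteq> 0"
  obtains m where "m \<noteq> 0" "m dvd (\<Prod>j<n. d j)"
    "\<And>k. m dvd k \<longleftrightarrow> (\<forall>j<n. d j dvd k * v j)"
proof -
  define m where "m = Lcm ((\<lambda>j. d j div gcd (d j) (v j)) ` {..<n})"
  have *: "d j div gcd (d j) (v j) dvd k \<longleftrightarrow> d j dvd k * v j" if j: "j < n" for j k
  proof -
    let ?g = "gcd (d j) (v j)"
    have g: "?g \<noteq> 0" using assms[OF j] by simp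
    have "coprime (d j div ?g) (v j div ?g)"
      using assms[OF j] by (intro div_gcd_coprime) simp
    then have "d j div ?g dvd k \<longleftrightarrow> d j div ?g dvd k * (v j div ?g)"
      by (simp add: coprime_dvd_mult_left_iff)
    also have "\<dots> \<longleftrightarrow> d j div ?g * ?g dvd k * (v j div ?g) * ?g"
      using g by (simp only: dvd_mult_cancel_right simp_thms)
    finally show ?thesis by (simp add: mult.assoc)
  qed
  have m: "m dvd k \<longleftrightarrow> (\<forall>j<n. d j dvd k * v j)" for k
    using * by (auto simp: m_def Lcm_dvd_iff)
  moreover have dvd: "m dvd (\<Prod>j<n. d j)"
    unfolding m by (auto intro!: dvd_mult2 dvd_prodI)
  moreover have "m \<noteq> 0" using dvd assms by auto
  ultimately show ?thesis using that by blast
qed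

lemma det_diagonal_mat:
  assumes "A \<in> carrier_mat n n" "diagonal_mat A"
  shows "det A = (\<Prod>j<n. A $$ (j, j))"
proof -
  have "upper_triangular A" using assms by (auto simp: diagonal_mat_def)
  from det_upper_triangular[OF this assms(1)] assms(1) show ?thesis
    by (simp add: prod_list_diag_prod atLeast0LessThan)
qed

lemma diagonal_mult_mat_vec:
  assumes "A \<in> carrier_mat n n" "diagonal_mat A" "v \<in> carrier_vec n" "j < n"
  shows "(A *\<^sub>v v) $ j = A $$ (j, j) * v $ j"
proof -
  have "(A *\<^sub>v v) $ j = (\<Sum>l = 0..<n. A $$ (j, l) * v $ l)"
    using assms by (simp add: scalar_prod_def)
  also have "\<dots> = (\<Sum>l = 0..<n. if l = j then A $$ (j, j) * v $ j else 0)"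
    using assms by (intro sum.cong) (auto simp: diagonal_mat_def)
  finally show ?thesis using assms(4) by simp
qed

definition coords :: "'u elt ab_hom \<Rightarrow> nat \<Rightarrow> int" where
  "coords \<beta> j = the_vec (fn \<beta> (Int_elt 1)) $ j"

lemma Hom_Z_Zn_apply:
  assumes "\<beta> \<in> Hom Ab Z_grp (Zn_grp n)"
  shows "fn \<beta> (Int_elt k) = Vec_elt (vec n (\<lambda>j. k * coords \<beta> j))"
proof -
  have eq: "\<beta> = hom_to_Zn n Z_grp (\<lambda>x j. the_int x * coords \<beta> j)"
  proof (rule Hom_from_Z_eqI[OF assms])
    show "hom_to_Zn n Z_grp (\<lambda>x j. the_int x * coords \<beta> j) \<in> Hom Ab Z_grp (Zn_grp n)"
      by (rule hom_to_Zn_in_Hom) (simp_all add: comm_group_Z_grp the_int_mult_Z_grp algebra_simps)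
    obtain v where "fn \<beta> (Int_elt 1) = Vec_elt v" "v \<in> carrier_vec n"
      using Hom_AbD(9)[OF assms, of "Int_elt 1"] by (auto simp: carrier_Zn_grp)
    then show "fn \<beta> (Int_elt 1) = fn (hom_to_Zn n Z_grp (\<lambda>x j. the_int x * coords \<beta> j)) (Int_elt 1)"
      by (auto simp: coords_def)
  qed
  show ?thesis
    using arg_cong[OF eq, of "\<lambda>h. fn h (Int_elt k)"] by simp
qed

text \<open>Dividing each coordinate of \<open>h\<close> by the diagonal entry is again a homomorphism, so
  divisibility of the values is all that a factorisation requires, whatever the group \<open>G\<close> is.\<close>

lemma factors_through_diagonal_iff:
  assumes A: "A \<in> carrier_mat n n" "diagonal_mat A" "\<And>j. j < n \<Longrightarrow> A $$ (j, j) \<noteq> 0"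
    and h: "h \<in> Hom Ab G (Zn_grp n)"
  shows "(\<exists>g \<in> Hom Ab G (Zn_grp n). h = Cmp Ab (mat_hom n A) g) \<longleftrightarrow>
    (\<forall>x \<in> carrier G. \<forall>j<n. A $$ (j, j) dvd the_vec (fn h x) $ j)" (is "?L \<longleftrightarrow> ?R")
proof -
  have app: "fn (Cmp Ab (mat_hom n A) g) x = Vec_elt (A *\<^sub>v the_vec (fn g x))"
    "the_vec (fn g x) \<in> carrier_vec n"
    if "g \<in> Hom Ab G (Zn_grp n)" "x \<in> carrier G" for g x
    using Hom_AbD(1)[OF that(1)] Hom_AbD(9)[OF that] that(2)
    by (auto simp: Cmp_Ab_apply mat_hom_def carrier_Zn_grp)
  show ?thesis
  proof
    assume ?L
    then show ?R
      using app by (auto simp: diagonal_mult_mat_vec[OF A(1,2)])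
  next
    assume R: ?R
    define g where "g = hom_to_Zn n G (\<lambda>x j. the_vec (fn h x) $ j div A $$ (j, j))"
    have g: "g \<in> Hom Ab G (Zn_grp n)"
      unfolding g_def using R Hom_AbD(3)[OF h]
      by (intro hom_to_Zn_in_Hom) (simp_all add: the_vec_fn_mult[OF h] div_plus_div_distrib_dvd_left)
    have "h = Cmp Ab (mat_hom n A) g"
    proof (rule Hom_Ab_eqI[OF h Cmp_Ab_in[OF g mat_hom_in_Hom[OF A(1)]]])
      fix x assume x: "x \<in> carrier G"
      obtain v where v: "fn h x = Vec_elt v" "v \<in> carrier_vec n"
        using Hom_AbD(9)[OF h x] by (auto simp: carrier_Zn_grp)
      have "A *\<^sub>v the_vec (fn g x) = v"
      proof (rule eq_vecI)
        show "dim_vec (A *\<^sub>v the_vec (fn g x)) = dim_vec v" using A(1) v(2) by simp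
        show "(A *\<^sub>v the_vec (fn g x)) $ j = v $ j" if "j < dim_vec v" for j
        proof -
          have "j < n" using that v(2) by simp
          then show ?thesis
            using R x v diagonal_mult_mat_vec[OF A(1,2) app(2)[OF g x]] by (auto simp: g_def)
        qed
      qed
      then show "fn h x = fn (Cmp Ab (mat_hom n A) g) x" using app(1)[OF g x] v(1) by simp
    qed
    then show ?L using g by blast
  qed
qed

lemma pullback_generated_eq_div_sieve:
  fixes A :: "nat \<Rightarrow> int mat" and \<beta> :: "'u elt ab_hom"
  assumes A: "\<And>i. i \<in> I \<Longrightarrow> A i \<in> carrier_mat n n" "\<And>i. i \<in> I \<Longrightarrow> diagonal_mat (A i)"
    "\<And>i j. \<lbrakk>i \<in> I; j < n\<rbrakk> \<Longrightarrow> A i $$ (j, j) \<noteq> 0"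
    and \<beta>: "\<beta> \<in> Hom Ab Z_grp (Zn_grp n)"
    and m: "\<And>i k. i \<in> I \<Longrightarrow> m i dvd k \<longleftrightarrow> (\<forall>j<n. A i $$ (j, j) dvd k * coords \<beta> j)"
  shows "pullback_sieve Ab \<beta> (generated_sieve Ab {mat_hom n (A i) |i. i \<in> I}) = div_sieve (m ` I)"
proof -
  have gen: "h \<in> generated_sieve Ab {mat_hom n (A i) |i. i \<in> I} \<longleftrightarrow>
      (\<exists>i \<in> I. \<exists>g \<in> Hom Ab G (Zn_grp n). h = Cmp Ab (mat_hom n (A i)) g)"
    if h: "h \<in> Hom Ab G (Zn_grp n)" for h :: "'u elt ab_hom" and G
  proof -
    have src: "src (mat_hom n B :: 'u elt ab_hom) = Zn_grp n" for B by (simp add: mat_hom_def)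
    have "h \<in> generated_sieve Ab {mat_hom n (A i) |i. i \<in> I} \<longleftrightarrow>
        (\<exists>i \<in> I. \<exists>g \<in> Ars Ab. tgt g = Zn_grp n \<and> h = Cmp Ab (mat_hom n (A i)) g)"
      unfolding generated_sieve_def mem_Collect_eq Ab_simps using src by metis
    also have "\<dots> \<longleftrightarrow> (\<exists>i \<in> I. \<exists>g \<in> Hom Ab G (Zn_grp n). h = Cmp Ab (mat_hom n (A i)) g)"
    proof -
      have "src g = G" if "h = Cmp Ab (mat_hom n (A i)) g" for g i
        using Hom_AbD(1)[OF h] unfolding that by (simp add: Ab_def)
      then show ?thesis unfolding Hom_def Ab_simps by blast
    qed
    finally show ?thesis .
  qed
  have "\<beta> \<in> Ars Ab" "src \<beta> = Z_grp" using \<beta> by (auto simp: Hom_def)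
  have "f \<in> pullback_sieve Ab \<beta> (generated_sieve Ab {mat_hom n (A i) |i. i \<in> I}) \<longleftrightarrow>
      f \<in> div_sieve (m ` I)" if f: "f \<in> Ars Ab" "tgt f = Z_grp" for f
  proof -
    have f': "f \<in> Hom Ab (src f) Z_grp" using f by (simp add: Hom_src)
    note \<beta>f = Cmp_Ab_in[OF f' \<beta>]
    have coord: "the_vec (fn (Cmp Ab \<beta> f) x) $ j = the_int (fn f x) * coords \<beta> j"
      if "x \<in> carrier (src f)" "j < n" for x j
      using Hom_Z_Zn_apply[OF \<beta>, of "the_int (fn f x)"] Hom_AbD(9)[OF f' that(1)] that
      by (simp add: Cmp_Ab_apply)
    have "Cmp Ab \<beta> f \<in> generated_sieve Ab {mat_hom n (A i) |i. i \<in> I} \<longleftrightarrow>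
        (\<exists>i \<in> I. \<forall>x \<in> carrier (src f). m i dvd the_int (fn f x))"
      unfolding gen[OF \<beta>f]
      using factors_through_diagonal_iff[OF A \<beta>f] by (simp add: coord m)
    then show ?thesis
      using f \<open>src \<beta> = Z_grp\<close> by (simp add: pullback_sieve_def div_sieve_def)
  qed
  then show ?thesis
    using \<open>src \<beta> = Z_grp\<close> by (auto simp: pullback_sieve_def div_sieve_def)
qed

lemma colim_pullback_iff:
  fixes A :: "nat \<Rightarrow> int mat" and \<beta> :: "'u elt ab_hom"
  assumes A: "\<And>i. i \<in> I \<Longrightarrow> A i \<in> carrier_mat n n" "\<And>i. i \<in> I \<Longrightarrow> diagonal_mat (A i)"
    "\<And>i. i \<in> I \<Longrightarrow> det (A i) \<noteq> 0" and "finite I"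
    and \<beta>: "\<beta> \<in> Hom Ab Z_grp (Zn_grp n)"
  obtains m where "\<And>i. i \<in> I \<Longrightarrow> m i dvd det (A i)"
    "\<And>i k. i \<in> I \<Longrightarrow> m i dvd k \<longleftrightarrow> (\<forall>j<n. A i $$ (j, j) dvd k * coords \<beta> j)"
    "colim_sieve Ab Z_grp (pullback_sieve Ab \<beta> (generated_sieve Ab {mat_hom n (A i) |i. i \<in> I}))
       \<longleftrightarrow> Gcd (m ` I) = 1"
proof -
  have det: "det (A i) = (\<Prod>j<n. A i $$ (j, j))" if "i \<in> I" for i
    using det_diagonal_mat A(1,2) that by blast
  have nz: "A i $$ (j, j) \<noteq> 0" if "i \<in> I" "j < n" for i j
    using A(3)[OF that(1)] that(2) by (auto simp: det[OF that(1)])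
  have "\<forall>i \<in> I. \<exists>m. m \<noteq> 0 \<and> m dvd det (A i) \<and>
      (\<forall>k. m dvd k \<longleftrightarrow> (\<forall>j<n. A i $$ (j, j) dvd k * coords \<beta> j))"
  proof
    fix i assume i: "i \<in> I"
    show "\<exists>m. m \<noteq> 0 \<and> m dvd det (A i) \<and>
      (\<forall>k. m dvd k \<longleftrightarrow> (\<forall>j<n. A i $$ (j, j) dvd k * coords \<beta> j))"
      unfolding det[OF i]
      by (rule simultaneous_divisor[of n "\<lambda>j. A i $$ (j, j)" "coords \<beta>"]) (use nz[OF i] in blast)+
  qed
  from bchoice[OF this] obtain m where m: "\<forall>i \<in> I. m i \<noteq> 0 \<and> m i dvd det (A i) \<and>
      (\<forall>k. m i dvd k \<longleftrightarrow> (\<forall>j<n. A i $$ (j, j) dvd k * coords \<beta> j))" ..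
  have "pullback_sieve Ab \<beta> (generated_sieve Ab {mat_hom n (A i) |i. i \<in> I}) = div_sieve (m ` I)"
    using A(1,2) nz \<beta> m by (intro pullback_generated_eq_div_sieve) auto
  moreover have "0 \<notin> m ` I" using m by auto
  ultimately have "colim_sieve Ab Z_grp (pullback_sieve Ab \<beta>
      (generated_sieve Ab {mat_hom n (A i) |i. i \<in> I})) \<longleftrightarrow> Gcd (m ` I) = 1"
    using colim_div_sieve_iff[of "m ` I"] \<open>finite I\<close> by simp
  then show ?thesis using that[of m] m by blast
qed

theorem proposition5p25:
  fixes n N :: nat
    and A :: "nat \<Rightarrow> int mat"
    and S :: "'u elt ab_hom set"
  assumes "\<And>i. i \<in> {1..N} \<Longrightarrow> A i \<in> carrier_mat n n"
    and "\<And>i. i \<in> {1..N} \<Longrightarrow> diagonal_mat (A i)"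
    and "\<And>i. i \<in> {1..N} \<Longrightarrow> det (A i) \<noteq> 0"
    and "S = generated_sieve Ab {mat_hom n (A i) |i. i \<in> {1..N}}"
  shows "(\<exists>\<beta> \<in> Hom Ab Z_grp (Zn_grp n).
            \<not> colim_sieve Ab Z_grp (pullback_sieve Ab \<beta> S))
         \<longleftrightarrow> Gcd ((\<lambda>i. det (A i)) ` {1..N}) \<noteq> 1"
proof
  assume "\<exists>\<beta> \<in> Hom Ab Z_grp (Zn_grp n). \<not> colim_sieve Ab Z_grp (pullback_sieve Ab \<beta> S)"
  then obtain \<beta> where \<beta>: "\<beta> \<in> Hom Ab Z_grp (Zn_grp n)"
    "\<not> colim_sieve Ab Z_grp (pullback_sieve Ab \<beta> S)" by blast
  obtain m
    where m: "\<And>i. i \<in> {1..N} \<Longrightarrow> m i dvd det (A i)"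
      and "colim_sieve Ab Z_grp (pullback_sieve Ab \<beta> S) \<longleftrightarrow> Gcd (m ` {1..N}) = 1"
    by (rule colim_pullback_iff[of "{1..N}" A n \<beta>, folded assms(4)])
      (use assms(1-3) \<beta>(1) in blast)+
  then have ne: "Gcd (m ` {1..N}) \<noteq> 1" using \<beta>(2) by blast
  have "Gcd (m ` {1..N}) dvd det (A i)" if "i \<in> {1..N}" for i
    using dvd_trans[OF Gcd_dvd m] that by blast
  then have "Gcd (m ` {1..N}) dvd Gcd ((\<lambda>i. det (A i)) ` {1..N})"
    by (auto intro!: Gcd_greatest)
  then show "Gcd ((\<lambda>i. det (A i)) ` {1..N}) \<noteq> 1" using ne by auto
next
  assume ne: "Gcd ((\<lambda>i. det (A i)) ` {1..N}) \<noteq> 1"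
  \<comment> \<open>The vector \<open>(1, \<dots>, 1)\<close> makes \<open>m i\<close> a multiple of every diagonal entry of \<open>A i\<close>.\<close>
  define \<beta> :: "'u elt ab_hom" where "\<beta> = hom_to_Zn n Z_grp (\<lambda>x j. the_int x)"
  have \<beta>: "\<beta> \<in> Hom Ab Z_grp (Zn_grp n)"
    unfolding \<beta>_def by (rule hom_to_Zn_in_Hom) (simp_all add: comm_group_Z_grp the_int_mult_Z_grp)
  have ones: "coords \<beta> j = 1" if "j < n" for j using that by (simp add: coords_def \<beta>_def)
  obtain m
    where m: "\<And>i k. i \<in> {1..N} \<Longrightarrow> m i dvd k \<longleftrightarrow> (\<forall>j<n. A i $$ (j, j) dvd k * coords \<beta> j)"
      and iff: "colim_sieve Ab Z_grp (pullback_sieve Ab \<beta> S) \<longleftrightarrow> Gcd (m ` {1..N}) = 1"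
    by (rule colim_pullback_iff[of "{1..N}" A n \<beta>, folded assms(4)])
      (use assms(1-3) \<beta> in blast)+
  have entry_dvd: "A i $$ (j, j) dvd m i" if "i \<in> {1..N}" "j < n" for i j
    using m[OF that(1), of "m i"] that(2) ones[OF that(2)] by auto
  obtain p where p: "prime p" "p dvd Gcd ((\<lambda>i. det (A i)) ` {1..N})"
    using ne by (elim prime_factor_int[rotated]) simp
  have "p dvd m i" if i: "i \<in> {1..N}" for i
  proof -
    have "p dvd det (A i)"
      using dvd_trans[OF p(2) Gcd_dvd] i by blast
    then have "p dvd (\<Prod>j<n. A i $$ (j, j))"
      using det_diagonal_mat[OF assms(1,2)[OF i]] by simp
    then obtain j where "j < n" "p dvd A i $$ (j, j)"
      using p(1) by (auto simp: prime_dvd_prod_iff)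
    then show ?thesis using dvd_trans[OF _ entry_dvd[OF i]] by blast
  qed
  then have "p dvd Gcd (m ` {1..N})" by (auto intro!: Gcd_greatest)
  then have "Gcd (m ` {1..N}) \<noteq> 1" using p(1) by auto
  then show "\<exists>\<beta> \<in> Hom Ab Z_grp (Zn_grp n). \<not> colim_sieve Ab Z_grp (pullback_sieve Ab \<beta> S)"
    using iff \<beta> by blast
qed

end
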